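(* Let $h,q$ be coprime integers with $q>2$, and let $s\in\mathbb C$ with $\Re(s)>1$. Then $$L(s,\psi_{h/q})=\left(\prod_{\substack{\chi\bmod q\\ \chi\neq\chi_0}}L(s,\overline{\chi})^{\frac{\tau(\chi)\overline{\chi(h)}}{\phi(q)}}\right)\cdot\zeta(s)^{\frac{\mu(q)}{\phi(q)}}\cdot e^{U_{h,q}(s)},$$ where $$U_{h,q}(s):=-\frac{\mu(q)}{\phi(q)}\sum_{p\mid q}\sum_{k=1}^\infty\frac{1}{k p^{sk}}+\sum_{p\mid q}\sum_{k=1}^\infty\frac{e^{\frac{2\pi i h p^k}{q}}}{k\,p^{sk}}+\sum_p\sum_{k=2}^\infty\frac{e^{\frac{2\pi i p h k}{q}}-e^{\frac{2\pi i p^k h}{q}}}{k\,p^{sk}}.$$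
   Context: For a positive integer $n=\prod_{i=1}^r p_i^{a_i}$, $A(n):=\sum_i a_i p_i$. Define $\psi_{h/q}(n):=e^{2\pi i hA(n)/q}$ and, for $\Re(s)>1$, $L(s,\psi_{h/q}):=\sum_{n\ge1}\psi_{h/q}(n)n^{-s}$. Here $p$ runs over primes, $\chi$ over Dirichlet characters mod $q$, $\chi_0$ is the principal character, $\tau(\chi)=\sum_{\ell\bmod q}\chi(\ell)e^{2\pi i\ell/q}$, $\mu$ is the Möbius function, $\phi$ Euler's function, $\zeta$ the Riemann zeta function and $L(s,\chi)$ the Dirichlet $L$-function. For $\Re(s)>1$ and complex $a$, the powers are defined by $L(s,\chi)^a:=\exp\big(a\sum_p\sum_{k\ge1}\frac{\chi(p^k)}{kp^{ks}}\big)$ and $\zeta(s)^a:=\exp\big(a\sum_p\sum_{k\ge1}\frac{1}{kp^{ks}}\big)$. *)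

theory Defs
  imports "HOL-Analysis.Analysis" "HOL-Number_Theory.Number_Theory"
    "HOL-Computational_Algebra.Squarefree"
begin

definition A_fun :: "nat \<Rightarrow> nat" where
  "A_fun n = (\<Sum>p\<in>prime_factors n. multiplicity p n * p)"

definition expq :: "nat \<Rightarrow> int \<Rightarrow> complex" where
  "expq q m = exp (2 * of_real pi * \<i> * of_int m / of_nat q)"

definition psi :: "int \<Rightarrow> nat \<Rightarrow> nat \<Rightarrow> complex" where
  "psi h q n = expq q (h * int (A_fun n))"

text \<open>Every infinite sum below converges absolutely in the half-plane \<open>Re s > 1\<close>, so the
  unordered sum agrees there with summation in the natural order.\<close>

definition L_psi :: "int \<Rightarrow> nat \<Rightarrow> complex \<Rightarrow> complex" where
  "L_psi h q s = (\<Sum>\<^sub>\<infinity>n\<in>{1..}. psi h q n * of_nat n powr (- s))"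

definition dirichlet_character :: "nat \<Rightarrow> (int \<Rightarrow> complex) \<Rightarrow> bool" where
  "dirichlet_character q X \<longleftrightarrow>
     (\<forall>m n. X (m * n) = X m * X n) \<and>
     (\<forall>n. X (n + int q) = X n) \<and>
     (\<forall>n. X n \<noteq> 0 \<longleftrightarrow> coprime n (int q))"

definition principal_character :: "nat \<Rightarrow> int \<Rightarrow> complex" where
  "principal_character q n = (if coprime n (int q) then 1 else 0)"

definition gauss_sum :: "nat \<Rightarrow> (int \<Rightarrow> complex) \<Rightarrow> complex" where
  "gauss_sum q X = (\<Sum>l\<in>{0..<int q}. X l * expq q l)"

definition moebius_mu :: "nat \<Rightarrow> int" where
  "moebius_mu n = (if squarefree n then (-1) ^ card (prime_factors n) else 0)"

text \<open>The powers \<open>L(s,X)\<^sup>a\<close> and \<open>\<zeta>(s)\<^sup>a\<close> for \<open>Re s > 1\<close>: the branch of the logarithm is the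
  one given by the Euler product, which in general is not the principal one, so \<open>powr\<close> would
  be a different function.\<close>

definition L_power :: "(int \<Rightarrow> complex) \<Rightarrow> complex \<Rightarrow> complex \<Rightarrow> complex" where
  "L_power X s a =
     exp (a * (\<Sum>\<^sub>\<infinity>p\<in>{p::nat. prime p}. \<Sum>\<^sub>\<infinity>k\<in>{1::nat..}.
       X (int (p ^ k)) / (of_nat k * of_nat p powr (of_nat k * s))))"

definition zeta_power :: "complex \<Rightarrow> complex \<Rightarrow> complex" where
  "zeta_power s a =
     exp (a * (\<Sum>\<^sub>\<infinity>p\<in>{p::nat. prime p}. \<Sum>\<^sub>\<infinity>k\<in>{1::nat..}.
       1 / (of_nat k * of_nat p powr (of_nat k * s))))"

definition U_fun :: "int \<Rightarrow> nat \<Rightarrow> complex \<Rightarrow> complex" where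
  "U_fun h q s =
     - (of_int (moebius_mu q) / of_nat (totient q)) *
         (\<Sum>p\<in>prime_factors q. \<Sum>\<^sub>\<infinity>k\<in>{1::nat..}.
            1 / (of_nat k * of_nat p powr (s * of_nat k)))
     + (\<Sum>p\<in>prime_factors q. \<Sum>\<^sub>\<infinity>k\<in>{1::nat..}.
          expq q (h * int (p ^ k)) / (of_nat k * of_nat p powr (s * of_nat k)))
     + (\<Sum>\<^sub>\<infinity>p\<in>{p::nat. prime p}. \<Sum>\<^sub>\<infinity>k\<in>{2::nat..}.
          (expq q (int p * h * int k) - expq q (int (p ^ k) * h))
            / (of_nat k * of_nat p powr (s * of_nat k)))"

end

theory Submission
  imports Defs
begin

text \<open>
  Since \<open>A\<close> is completely additive, \<open>\<psi>\<close> is completely multiplicative with \<open>\<psi>(p) = e(hp/q)\<close>, and the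
  Euler product gives \<open>log L(s,\<psi>) = \<Sum>\<^sub>p \<Sum>\<^sub>k e(hpk/q) / (k p\<^sup>k\<^sup>s)\<close>. Replacing \<open>e(hpk/q)\<close> by
  \<open>e(hp\<^sup>k/q)\<close> costs the third sum of \<open>U\<close>. For \<open>p\<close> not dividing \<open>q\<close>, orthogonality of the Dirichlet
  characters expands \<open>e(hp\<^sup>k/q)\<close> in the values of the conjugate characters at \<open>hp\<^sup>k\<close>, with the Gauss
  sums over \<open>\<phi>(q)\<close> as coefficients; the principal character contributes \<open>\<mu>(q)/\<phi>(q)\<close>, because its
  Gauss sum is the Ramanujan sum. The other two sums of \<open>U\<close> correct the terms with \<open>p\<close> dividing \<open>q\<close>.
  All double series converge absolutely, so the theorem reduces to an identity between the
  coefficients at each prime power.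
\<close>

subsection \<open>Additive characters and the Ramanujan sum\<close>

lemma expq_0 [simp]: "expq q 0 = 1"
  by (simp add: expq_def)

lemma expq_add: "expq q (m + n) = expq q m * expq q n"
  by (simp add: expq_def exp_add [symmetric] ring_distribs add_divide_distrib)

lemma expq_mult_nat: "expq q (m * int k) = expq q m ^ k"
  by (simp add: expq_def exp_of_nat_mult [symmetric] mult_ac)

lemma norm_expq [simp]: "norm (expq q m) = 1"
proof -
  have "expq q m = cis (2 * pi * of_int m / of_nat q)"
    by (simp add: expq_def cis_conv_exp mult_ac)
  then show ?thesis by simp
qed

lemma expq_eq_1_iff:
  assumes "q > 0"
  shows "expq q m = 1 \<longleftrightarrow> int q dvd m"
proof -
  have "expq q m = exp (\<i> * of_real (2 * pi * of_int m / of_nat q))"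
    by (simp add: expq_def mult_ac)
  then have "expq q m = 1 \<longleftrightarrow> (\<exists>k::int. 2 * pi * of_int m / of_nat q = of_int (2 * k) * pi)"
    by (simp add: exp_eq_1)
  also have "\<dots> \<longleftrightarrow> (\<exists>k::int. m = int q * k)"
  proof (intro ex_cong1)
    fix k :: int
    have "2 * pi * of_int m / of_nat q = of_int (2 * k) * pi \<longleftrightarrow> of_int m = (of_int (int q * k) :: real)"
      using assms by (simp add: field_simps)
    then show "2 * pi * of_int m / of_nat q = of_int (2 * k) * pi \<longleftrightarrow> m = int q * k"
      by (metis of_int_eq_iff)
  qed
  finally show ?thesis by (simp add: dvd_def)
qed

lemma expq_cong:
  assumes "[m = n] (mod int q)" "q > 0"
  shows "expq q m = expq q n"
proof -
  have "expq q m = expq q n * expq q (m - n)"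
    by (simp add: expq_add [symmetric])
  moreover have "expq q (m - n) = 1"
    using assms by (simp add: expq_eq_1_iff cong_iff_dvd_diff)
  ultimately show ?thesis by simp
qed

text \<open>With \<open>q = d * n\<close> the multiples are \<open>d * j\<close> for
  \<open>j < n\<close>, so this is a geometric sum of length \<open>n\<close> in the
  \<open>n\<close>-th root of unity \<open>expq q d\<close>. That root is 1 only for
  \<open>d = q\<close>.\<close>

lemma sum_expq_multiples:
  assumes "d dvd q" "q > 0"
  shows "(\<Sum>l | l \<in> {0..<int q} \<and> int d dvd l. expq q l) = (if d = q then 1 else 0)"
proof -
  obtain n where q: "q = d * n" using assms(1) by blast
  have pos: "d > 0" "n > 0" using assms q by auto
  have "(\<Sum>l | l \<in> {0..<int q} \<and> int d dvd l. expq q l) = (\<Sum>j<n. expq q (int d * int j))"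
  proof (rule sum.reindex_bij_witness[of _ "\<lambda>j. int d * int j" "\<lambda>l. nat (l div int d)"])
    fix l assume l: "l \<in> {l. l \<in> {0..<int q} \<and> int d dvd l}"
    then obtain j where j: "l = int d * j" by blast
    then have "0 \<le> j" "j < int n"
      using l pos q by (auto simp: zero_le_mult_iff)
    then show "int d * int (nat (l div int d)) = l" "nat (l div int d) \<in> {..<n}"
      "expq q (int d * int (nat (l div int d))) = expq q l"
      using pos j by auto
  qed (use pos q in \<open>auto simp: nat_eq_iff simp flip: of_nat_mult zdiv_int\<close>)
  also have "\<dots> = (\<Sum>j<n. expq q (int d) ^ j)"
    by (simp add: expq_mult_nat)
  also have "\<dots> = (if d = q then 1 else 0)"
  proof (cases "d = q")
    case True
    moreover from this have "n = 1" using q pos by simp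
    ultimately show ?thesis by simp
  next
    case False
    then have "d < q" using pos q by (cases n) auto
    then have "expq q (int d) \<noteq> 1"
      using pos assms by (auto simp: expq_eq_1_iff dest: zdvd_imp_le)
    moreover have "expq q (int d) ^ n = 1"
      using assms q by (simp add: expq_mult_nat [symmetric] expq_eq_1_iff)
    ultimately show ?thesis using False by (simp add: geometric_sum)
  qed
  finally show ?thesis .
qed

section \<open>Products of distinct primes and inclusion-exclusion\<close>

lemma prod_primes_dvd_iff:
  assumes "finite S" "\<And>p. p \<in> S \<Longrightarrow> prime p"
  shows "\<Prod>S dvd (n::nat) \<longleftrightarrow> (\<forall>p\<in>S. p dvd n)"
  using assms
proof (induction S rule: finite_induct)
  case (insert p S)
  have "coprime p (\<Prod>S)"
    using insert by (intro prod_coprime_right) (metis insertCI primes_coprime)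
  then have "p * \<Prod>S dvd n \<longleftrightarrow> p dvd n \<and> \<Prod>S dvd n"
    by (meson divides_mult dvd_mult_left dvd_mult_right)
  then show ?case using insert by simp
qed simp

text \<open>Decides which sets \<open>S\<close> survive in the inclusion-exclusion for the Ramanujan
  sum: a product of distinct primes is squarefree, and every prime factor of \<open>q\<close> must
  occur in it.\<close>

lemma prod_prime_factors_eq_iff:
  assumes "q > 0" "S \<subseteq> prime_factors q"
  shows "\<Prod>S = (q::nat) \<longleftrightarrow> squarefree q \<and> S = prime_factors q"
proof
  assume eq: "\<Prod>S = q"
  have fin: "finite S" using assms(2) finite_subset by blast
  have primes: "\<And>p. p \<in> S \<Longrightarrow> prime p" using assms(2) by auto
  have "squarefree (\<Prod>S)"
    using primes by (intro squarefree_prod_coprime) (auto intro: primes_coprime squarefree_prime)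
  moreover have "prime_factors q \<subseteq> S"
  proof
    fix p assume p: "p \<in> prime_factors q"
    then have "p dvd \<Prod>S" "prime p" using eq by auto
    then obtain r where "r \<in> S" "p dvd r"
      using prime_dvd_prod_iff[OF fin \<open>prime p\<close>, of "\<lambda>x. x"] by blast
    moreover have "p = r"
      using primes_dvd_imp_eq[OF \<open>prime p\<close> primes] calculation by blast
    ultimately show "p \<in> S" by simp
  qed
  ultimately show "squarefree q \<and> S = prime_factors q"
    using eq assms(2) by auto
next
  assume *: "squarefree q \<and> S = prime_factors q"
  have "q = (\<Prod>p\<in>prime_factors q. p ^ multiplicity p q)"
    using assms(1) prime_factorization_nat by blast
  also have "\<dots> = \<Prod>S"
    using * assms(1) by (intro prod.cong) (auto simp: squarefree_factorial_semiring')
  finally show "\<Prod>S = q" by simp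
qed

lemma coprime_iff_no_prime_factor_dvd:
  assumes "q > 0"
  shows "coprime n (q::nat) \<longleftrightarrow> (\<forall>p\<in>prime_factors q. \<not> p dvd n)"
proof
  assume cop: "coprime n q"
  show "\<forall>p\<in>prime_factors q. \<not> p dvd n"
  proof (intro ballI notI)
    fix p assume p: "p \<in> prime_factors q" "p dvd n"
    then have "is_unit p"
      using coprime_common_divisor[OF cop] by blast
    then show False
      using p(1) by (simp add: in_prime_factors_iff)
  qed
next
  assume *: "\<forall>p\<in>prime_factors q. \<not> p dvd n"
  show "coprime n q"
  proof (rule ccontr)
    assume "\<not> coprime n q"
    then obtain p where "prime p" "p dvd gcd n q"
      using prime_factor_nat[of "gcd n q"] coprime_iff_gcd_eq_1 by blast
    then show False
      using * assms by (auto simp: in_prime_factors_iff)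
  qed
qed

text \<open>Inclusion-exclusion over the prime factors of \<open>q\<close>: the sum over the multiples of a proper divisor
  of \<open>q\<close> vanishes, so only a set of primes with product \<open>q\<close> contributes.\<close>

lemma ramanujan_sum_one:
  assumes "q > 0"
  shows "(\<Sum>l | l \<in> {0..<int q} \<and> coprime l (int q). expq q l) = of_int (moebius_mu q)"
proof -
  let ?P = "prime_factors q"
  \<comment> \<open>Expanding the product of \<open>1 - [p dvd l]\<close> over the prime factors
    \<open>p\<close> of \<open>q\<close> writes coprimality as a signed sum over subsets.\<close>
  have ind: "(if coprime l (int q) then 1 else 0) =
      (\<Sum>S\<in>Pow ?P. (-1) ^ card S * (if int (\<Prod>S) dvd l then 1 else 0 :: complex))"
    if l_range: "l \<in> {0..<int q}" for l
  proof -
    obtain n where l: "l = int n"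
      using l_range nonneg_int_cases[of l] by auto
    have "coprime l (int q) \<longleftrightarrow> (\<forall>p\<in>?P. \<not> int p dvd l)"
      using assms by (simp only: l coprime_int_iff of_nat_dvd_iff coprime_iff_no_prime_factor_dvd)
    then have "(if coprime l (int q) then 1 else 0) = (\<Prod>p\<in>?P. 1 - (if int p dvd l then 1 else 0 :: complex))"
      by (auto intro!: prod.neutral[symmetric] prod_zero[symmetric])
    also have "\<dots> = (\<Sum>S\<in>Pow ?P. (-1) ^ card S * (\<Prod>p\<in>S. if int p dvd l then 1 else 0))"
      by (subst prod_diff_conv_sum) simp_all
    also have "\<dots> = (\<Sum>S\<in>Pow ?P. (-1) ^ card S * (if int (\<Prod>S) dvd l then 1 else 0))"
    proof (intro sum.cong refl arg_cong2[where f = "(*)"])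
      fix S assume "S \<in> Pow ?P"
      then have S: "finite S" "\<And>p. p \<in> S \<Longrightarrow> prime p"
        by (auto intro: finite_subset)
      have "int (\<Prod>S) dvd l \<longleftrightarrow> (\<forall>p\<in>S. int p dvd l)"
        using prod_primes_dvd_iff[OF S, of n] by (simp only: l of_nat_dvd_iff)
      then show "(\<Prod>p\<in>S. if int p dvd l then 1 else 0) = (if int (\<Prod>S) dvd l then 1 else 0 :: complex)"
        using S(1) by (auto intro!: prod.neutral prod_zero)
    qed
    finally show ?thesis .
  qed
  have "(\<Sum>l | l \<in> {0..<int q} \<and> coprime l (int q). expq q l) =
      (\<Sum>l\<in>{0..<int q}. (if coprime l (int q) then 1 else 0) * expq q l)"
    by (rule sum.mono_neutral_cong_left) auto
  also have "\<dots> = (\<Sum>l\<in>{0..<int q}. \<Sum>S\<in>Pow ?P. (-1) ^ card S * ((if int (\<Prod>S) dvd l then 1 else 0) * expq q l))"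
    by (intro sum.cong refl) (simp only: ind sum_distrib_right mult.assoc)
  also have "\<dots> = (\<Sum>S\<in>Pow ?P. (-1) ^ card S * (\<Sum>l\<in>{0..<int q}. (if int (\<Prod>S) dvd l then 1 else 0) * expq q l))"
    by (subst sum.swap) (simp only: sum_distrib_left)
  also have "\<dots> = (\<Sum>S\<in>Pow ?P. (-1) ^ card S * (if \<Prod>S = q then 1 else 0))"
  proof (intro sum.cong refl arg_cong2[where f = "(*)"])
    fix S assume "S \<in> Pow ?P"
    then have S: "finite S" "\<And>p. p \<in> S \<Longrightarrow> prime p" "\<And>p. p \<in> S \<Longrightarrow> p dvd q"
      by (auto intro: finite_subset)
    have "(\<Sum>l\<in>{0..<int q}. (if int (\<Prod>S) dvd l then 1 else 0) * expq q l) =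
        (\<Sum>l | l \<in> {0..<int q} \<and> int (\<Prod>S) dvd l. expq q l)"
      by (rule sum.mono_neutral_cong_right) auto
    also have "\<dots> = (if \<Prod>S = q then 1 else 0)"
      using S assms by (intro sum_expq_multiples) (simp_all add: prod_primes_dvd_iff)
    finally show "(\<Sum>l\<in>{0..<int q}. (if int (\<Prod>S) dvd l then 1 else 0) * expq q l) =
        (if \<Prod>S = q then 1 else 0)" .
  qed
  \<comment> \<open>Only the full set of prime factors remains, and only for squarefree
    \<open>q\<close>; its sign is the Moebius value.\<close>
  also have "\<dots> = (\<Sum>S\<in>Pow ?P. if S = ?P then (if squarefree q then (-1) ^ card S else 0) else 0)"
    using assms by (intro sum.cong refl) (auto simp: prod_prime_factors_eq_iff)
  also have "\<dots> = of_int (moebius_mu q)"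
    by (simp add: moebius_mu_def)
  finally show ?thesis .
qed

subsection \<open>Dirichlet characters\<close>

text \<open>Replaces \<open>a\<close> by its representative in \<open>[0, q)\<close> and applies
  Euler's theorem for natural numbers; for \<open>q = 0\<close> the exponent is 0.\<close>

lemma euler_theorem_int:
  fixes a :: int
  assumes "coprime a (int q)"
  shows "[a ^ totient q = 1] (mod int q)"
proof (cases "q = 0")
  case True
  then show ?thesis by simp
next
  case False
  define b where "b = nat (a mod int q)"
  have b: "int b = a mod int q"
    using False by (simp add: b_def)
  then have c: "[a = int b] (mod int q)"
    by (simp add: cong_def)
  have "coprime (int b) (int q)"
    using b assms False by (simp add: coprime_mod_left_iff)
  then have "[b ^ totient q = 1] (mod q)"
    by (intro euler_theorem) simp
  then have "[int b ^ totient q = 1] (mod int q)"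
    by (metis cong_int_iff of_nat_1 of_nat_power)
  then show ?thesis
    using c cong_pow cong_trans by blast
qed

text \<open>A character of the subgroup of residue classes represented by \<open>H\<close>; characters are extended from
  subgroup to subgroup to separate residue classes.\<close>

definition partial_character :: "nat \<Rightarrow> int set \<Rightarrow> (int \<Rightarrow> complex) \<Rightarrow> bool" where
  "partial_character q H f \<longleftrightarrow>
     1 \<in> H \<and>
     (\<forall>x\<in>H. coprime x (int q) \<and> f x \<noteq> 0) \<and>
     (\<forall>x\<in>H. \<forall>y\<in>H. x * y \<in> H \<and> f (x * y) = f x * f y) \<and>
     (\<forall>x\<in>H. \<forall>y. [x = y] (mod int q) \<longrightarrow> y \<in> H \<and> f y = f x)"

lemma partial_characterD:
  assumes "partial_character q H f"
  shows "1 \<in> H" "x \<in> H \<Longrightarrow> coprime x (int q)" "x \<in> H \<Longrightarrow> f x \<noteq> 0"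
    "x \<in> H \<Longrightarrow> y \<in> H \<Longrightarrow> x * y \<in> H" "x \<in> H \<Longrightarrow> y \<in> H \<Longrightarrow> f (x * y) = f x * f y"
    "x \<in> H \<Longrightarrow> [x = y] (mod int q) \<Longrightarrow> y \<in> H" "x \<in> H \<Longrightarrow> [x = y] (mod int q) \<Longrightarrow> f y = f x"
  using assms unfolding partial_character_def by blast+

lemma partial_character_one:
  assumes "partial_character q H f"
  shows "f 1 = 1"
proof -
  have "f 1 * f 1 = f 1"
    using partial_characterD(5)[OF assms, of 1 1] partial_characterD(1)[OF assms] by simp
  then show ?thesis
    using partial_characterD(1,3)[OF assms] by auto
qed

lemma partial_character_power:
  assumes "partial_character q H f" "x \<in> H"
  shows "x ^ n \<in> H" "f (x ^ n) = f x ^ n"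
proof (induction n)
  case 0
  case 1
  show ?case using partial_characterD(1)[OF assms(1)] by simp
  case 2
  show ?case using partial_character_one[OF assms(1)] by simp
next
  case (Suc n)
  case 1
  show ?case using Suc partial_characterD(4)[OF assms(1)] assms(2) by simp
  case 2
  show ?case using Suc partial_characterD(5)[OF assms(1)] assms(2) by simp
qed

text \<open>Closure under products already gives closure under division, because the inverse of the
  class of \<open>y\<close> is a power of \<open>y\<close> by Euler's theorem.\<close>

lemma partial_character_divide:
  assumes "partial_character q H f" "x \<in> H" "y \<in> H" "[x = y * w] (mod int q)"
  shows "w \<in> H"
proof (cases "q = 0")
  \<comment> \<open>Congruence modulo 0 is equality, so \<open>y\<close> is 1 or -1 and is its own
    inverse.\<close>
  case True
  then have x: "x = y * w" "is_unit y"
    using assms(4) partial_characterD(2)[OF assms(1,3)] by auto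
  then have "w = y * x"
    by (auto simp: zmult_eq_1_iff)
  then show ?thesis using partial_characterD(4)[OF assms(1,3,2)] by simp
next
  case False
  then obtain n where n: "totient q = Suc n"
    by (metis gr0_implies_Suc gr0I totient_gt_0_iff)
  have "[y ^ Suc n = 1] (mod int q)"
    using euler_theorem_int[of y q] partial_characterD(2)[OF assms(1,3)] n by simp
  then have "[w * y ^ Suc n = w] (mod int q)"
    using cong_scalar_left by fastforce
  moreover have "[y ^ n * x = y ^ n * (y * w)] (mod int q)"
    using assms(4) by (rule cong_scalar_left)
  ultimately have "[y ^ n * x = w] (mod int q)"
    by (simp add: mult_ac cong_def)
  moreover have "y ^ n * x \<in> H"
    using assms partial_character_power partial_characterD(4) by metis
  ultimately show ?thesis
    using partial_characterD(6)[OF assms(1)] by blast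
qed

text \<open>Adjoins \<open>a\<close> to \<open>H\<close> by \<open>y a\<^sup>k \<mapsto> f y z\<^sup>k\<close>.\<close>

lemma partial_character_extend_by:
  assumes pc: "partial_character q H f" and a: "coprime a (int q)" and z: "z \<noteq> 0"
    and compat: "\<And>m. a ^ m \<in> H \<Longrightarrow> f (a ^ m) = z ^ m"
  obtains H' f' where "partial_character q H' f'" "H \<subseteq> H'" "\<And>x. x \<in> H \<Longrightarrow> f' x = f x"
    "a \<in> H'" "f' a = z"
proof -
  \<comment> \<open>Independence of the representation \<open>y * a ^ k\<close>: cancelling the
    smaller power of \<open>a\<close> shows that the remaining \<open>a ^ d\<close> lies in
    \<open>H\<close>, where \<open>compat\<close> prescribes its value.\<close>
  have uniq': "f y * z ^ k = f y' * z ^ k'"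
    if "y \<in> H" "y' \<in> H" "[y * a ^ k = y' * a ^ k'] (mod int q)" "k \<le> k'" for y y' k k'
  proof -
    obtain d where d: "k' = k + d"
      using \<open>k \<le> k'\<close> le_Suc_ex by blast
    have "[y * a ^ k = (y' * a ^ d) * a ^ k] (mod int q)"
      using that(3) by (simp add: d power_add mult_ac)
    then have c: "[y = y' * a ^ d] (mod int q)"
      using a by (simp add: cong_mult_rcancel)
    then have "a ^ d \<in> H"
      using partial_character_divide[OF pc] that by blast
    then have "f y = f y' * z ^ d"
      using partial_characterD(5,7)[OF pc] that c compat cong_sym by metis
    then show ?thesis by (simp add: d power_add)
  qed
  have uniq: "f y * z ^ k = f y' * z ^ k'"
    if "y \<in> H" "y' \<in> H" "[y * a ^ k = y' * a ^ k'] (mod int q)" for y y' k k'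
    using uniq'[OF that] uniq'[OF that(2,1) cong_sym[OF that(3)]] by (metis nle_le)
  define H' where "H' = {x. \<exists>y\<in>H. \<exists>k. [x = y * a ^ k] (mod int q)}"
  define f' where "f' x = (SOME w. \<exists>y\<in>H. \<exists>k. [x = y * a ^ k] (mod int q) \<and> w = f y * z ^ k)" for x
  have f': "f' x = f y * z ^ k" if "y \<in> H" "[x = y * a ^ k] (mod int q)" for x y k
  proof -
    have "\<exists>w. \<exists>y\<in>H. \<exists>k. [x = y * a ^ k] (mod int q) \<and> w = f y * z ^ k"
      using that by blast
    from someI_ex[OF this] obtain y' k' where
      "y' \<in> H" "[x = y' * a ^ k'] (mod int q)" "f' x = f y' * z ^ k'"
      unfolding f'_def by blast
    moreover from this have "[y * a ^ k = y' * a ^ k'] (mod int q)"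
      using that(2) cong_sym cong_trans by blast
    ultimately show ?thesis
      using uniq[OF that(1)] by simp
  qed
  have H'E: "\<exists>y k. y \<in> H \<and> [x = y * a ^ k] (mod int q) \<and> f' x = f y * z ^ k" if "x \<in> H'" for x
    using that f' unfolding H'_def by blast
  have sub: "x \<in> H'" "f' x = f x" if "x \<in> H" for x
    using that f'[of x x 0] unfolding H'_def by (auto intro!: bexI[of _ x] exI[of _ 0])
  have aH': "a \<in> H'" "f' a = z"
    using f'[of 1 a 1] partial_characterD(1)[OF pc] partial_character_one[OF pc]
    unfolding H'_def by (auto intro!: bexI[of _ 1] exI[of _ 1])
  have "partial_character q H' f'"
    unfolding partial_character_def
  proof (intro conjI ballI allI impI)
    show "1 \<in> H'" using sub partial_characterD(1)[OF pc] by blast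
  next
    fix x assume "x \<in> H'"
    then obtain y k where y: "y \<in> H" "[x = y * a ^ k] (mod int q)" "f' x = f y * z ^ k"
      using H'E by blast
    have "coprime (y * a ^ k) (int q)"
      using a partial_characterD(2)[OF pc y(1)] by simp
    then show "coprime x (int q)"
      using y(2) cong_imp_coprime cong_sym by blast
    show "f' x \<noteq> 0"
      using y z partial_characterD(3)[OF pc] by simp
    {
      fix x' assume "x' \<in> H'"
      then obtain y' k' where y': "y' \<in> H" "[x' = y' * a ^ k'] (mod int q)" "f' x' = f y' * z ^ k'"
        using H'E by blast
      have *: "[x * x' = (y * y') * a ^ (k + k')] (mod int q)"
        using cong_mult[OF y(2) y'(2)] by (simp add: power_add mult_ac)
      have yy: "y * y' \<in> H" "f (y * y') = f y * f y'"
        using partial_characterD(4,5)[OF pc] y y' by auto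
      show "x * x' \<in> H'"
        using yy * unfolding H'_def by blast
      show "f' (x * x') = f' x * f' x'"
        using f'[OF yy(1) *] yy y y' by (simp add: power_add)
    next
      fix x' assume "[x = x'] (mod int q)"
      then have *: "[x' = y * a ^ k] (mod int q)"
        using y(2) cong_sym cong_trans by blast
      show "x' \<in> H'"
        using y * unfolding H'_def by blast
      show "f' x' = f' x"
        using f'[OF y(1) *] y by simp
    }
  qed
  then show ?thesis
    using that sub aH' by blast
qed

text \<open>Elements of \<open>A\<close> are adjoined one at a time. The value at a new
  \<open>a\<close> may be any root of the prescribed value at its first power in the subgroup, and
  complex roots always exist.\<close>

lemma partial_character_extend:
  assumes "partial_character q H f" "finite A" "\<And>a. a \<in> A \<Longrightarrow> coprime a (int q)" "q > 0"
  shows "\<exists>H' f'. partial_character q H' f' \<and> H \<subseteq> H' \<and> A \<subseteq> H' \<and> (\<forall>x\<in>H. f' x = f x)"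
  using assms(2,3)
proof (induction A rule: finite_induct)
  case empty
  then show ?case using assms(1) by blast
next
  case (insert a A)
  then obtain H' f' where pc: "partial_character q H' f'"
    and H': "H \<subseteq> H'" "A \<subseteq> H'" "\<forall>x\<in>H. f' x = f x"
    by auto
  have a: "coprime a (int q)" using insert.prems by simp
  \<comment> \<open>The order of \<open>a\<close> modulo the subgroup \<open>H'\<close>, finite by
    Euler's theorem.\<close>
  define n where "n = (LEAST n. 0 < n \<and> a ^ n \<in> H')"
  have "0 < totient q \<and> a ^ totient q \<in> H'"
    using partial_characterD(6)[OF pc partial_characterD(1)[OF pc] cong_sym[OF euler_theorem_int[OF a]]]
      \<open>q > 0\<close> by simp
  then have "0 < n \<and> a ^ n \<in> H'"
    unfolding n_def by (rule LeastI)
  then have n: "0 < n" "a ^ n \<in> H'" by auto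
  obtain z where z: "z ^ n = f' (a ^ n)"
    using n(1) by (metis exists_complex_root less_not_refl)
  have "z \<noteq> 0"
    using z n(1) partial_characterD(3)[OF pc n(2)] by (auto simp: zero_power)
  \<comment> \<open>Minimality of \<open>n\<close> makes every such \<open>m\<close> a multiple of
    \<open>n\<close>, so the choice of \<open>z ^ n\<close> settles all these values.\<close>
  moreover have "f' (a ^ m) = z ^ m" if "a ^ m \<in> H'" for m
  proof -
    have m: "a ^ m = (a ^ n) ^ (m div n) * a ^ (m mod n)"
      by (metis mult_div_mod_eq power_add power_mult)
    have "a ^ (m mod n) \<in> H'"
      using partial_character_divide[OF pc that partial_character_power(1)[OF pc n(2), of "m div n"]] m
      by simp
    then have "m mod n = 0"
      using not_less_Least[of "m mod n" "\<lambda>n. 0 < n \<and> a ^ n \<in> H'"] n(1)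
      unfolding n_def[symmetric] by auto
    then show ?thesis
      using partial_character_power(2)[OF pc n(2), of "m div n"] z m
      by (metis mult.right_neutral power_0 power_mult mult_div_mod_eq add.right_neutral)
  qed
  ultimately obtain H'' f'' where "partial_character q H'' f''" "H' \<subseteq> H''"
      "\<And>x. x \<in> H' \<Longrightarrow> f'' x = f' x" "a \<in> H''"
    using partial_character_extend_by[OF pc a, of z] by metis
  then show ?case using H'
    by (metis (no_types, lifting) insert_subset subset_iff)
qed

text \<open>The trivial character on the class of 1 is extended to the powers of \<open>c\<close> by
  sending \<open>c\<close> to a primitive root of unity of the same order as \<open>c\<close>, then
  to all units modulo \<open>q\<close>, and finally by zero.\<close>

lemma dirichlet_character_separates:
  assumes c: "coprime c (int q)" "\<not> [c = 1] (mod int q)" and "q > 0"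
  shows "\<exists>X. dirichlet_character q X \<and> X c \<noteq> 1"
proof -
  let ?H = "{x. [x = 1] (mod int q)}"
  have pc: "partial_character q ?H (\<lambda>_. 1)"
    unfolding partial_character_def
    using cong_mult[of _ 1 "int q" _ 1] cong_imp_coprime[of 1 _ "int q"]
    by (auto intro: cong_sym cong_trans)
  define n where "n = (LEAST n. 0 < n \<and> [c ^ n = 1] (mod int q))"
  have "0 < totient q \<and> [c ^ totient q = 1] (mod int q)"
    using euler_theorem_int[OF c(1)] \<open>q > 0\<close> by simp
  then have "0 < n \<and> [c ^ n = 1] (mod int q)"
    unfolding n_def by (rule LeastI)
  then have n: "0 < n" "[c ^ n = 1] (mod int q)" by auto
  have "n \<noteq> 1" using n c by auto
  then have "n > 1" using n by simp
  define z where "z = expq n 1"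
  have zn: "z ^ n = 1"
    using n(1) by (simp add: z_def expq_eq_1_iff flip: expq_mult_nat)
  have "z \<noteq> 1"
    using \<open>n > 1\<close> by (simp add: z_def expq_eq_1_iff)
  \<comment> \<open>The order \<open>n\<close> of \<open>c\<close> divides \<open>m\<close>; this is
    the compatibility required for adjoining \<open>c\<close>.\<close>
  have "1 = z ^ m" if "c ^ m \<in> ?H" for m
  proof -
    have "c ^ m = (c ^ n) ^ (m div n) * c ^ (m mod n)"
      by (metis mult_div_mod_eq power_add power_mult)
    then have "[c ^ m = c ^ (m mod n)] (mod int q)"
      using cong_scalar_right[OF cong_pow[OF n(2), of "m div n"], of "c ^ (m mod n)"] by simp
    then have "[c ^ (m mod n) = 1] (mod int q)"
      using that cong_sym cong_trans by blast
    then have "m mod n = 0"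
      using not_less_Least[of "m mod n" "\<lambda>n. 0 < n \<and> [c ^ n = 1] (mod int q)"] n(1)
      unfolding n_def[symmetric] by auto
    then show ?thesis
      by (metis zn power_mult power_one mult_div_mod_eq add.right_neutral)
  qed
  then obtain H1 f1 where pc1: "partial_character q H1 f1" and H1: "c \<in> H1" "f1 c = z"
    using partial_character_extend_by[OF pc c(1), of z] zn n(1)
    by (metis power_0_left less_not_refl zero_neq_one)
  let ?A = "{x \<in> {0..<int q}. coprime x (int q)}"
  have "finite ?A"
    by (rule finite_subset[of _ "{0..<int q}"]) auto
  then have "\<exists>H f. partial_character q H f \<and> H1 \<subseteq> H \<and> ?A \<subseteq> H \<and> (\<forall>x\<in>H1. f x = f1 x)"
    by (rule partial_character_extend[OF pc1]) (use \<open>q > 0\<close> in auto)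
  then obtain H f where pcf: "partial_character q H f" and H: "H1 \<subseteq> H" "?A \<subseteq> H" "\<forall>x\<in>H1. f x = f1 x"
    by blast
  \<comment> \<open>\<open>H\<close> contains a representative of each reduced class and is closed
    under congruence.\<close>
  have full: "x \<in> H \<longleftrightarrow> coprime x (int q)" for x
  proof
    assume x: "coprime x (int q)"
    then have "x mod int q \<in> ?A"
      using \<open>q > 0\<close> by (simp add: coprime_mod_left_iff)
    then show "x \<in> H"
      using H(2) partial_characterD(6)[OF pcf] by (meson cong_mod_left cong_refl subsetD)
  qed (use partial_characterD[OF pcf] in blast)
  define X where "X x = (if coprime x (int q) then f x else 0)" for x
  have "dirichlet_character q X"
    unfolding dirichlet_character_def
  proof (intro conjI allI)
    show "X (m * n) = X m * X n" for m n
      using partial_characterD(5)[OF pcf, of m n] by (auto simp: X_def full)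
    show "X (n + int q) = X n" for n
    proof -
      have "[n = n + int q] (mod int q)" by (simp add: cong_def)
      moreover have "coprime (n + int q) (int q) \<longleftrightarrow> coprime n (int q)"
        by (simp add: coprime_iff_gcd_eq_1)
      ultimately show ?thesis
        using partial_characterD(7)[OF pcf, of n "n + int q"] by (auto simp: X_def full)
    qed
    show "X n \<noteq> 0 \<longleftrightarrow> coprime n (int q)" for n
      using partial_characterD(3)[OF pcf, of n] by (auto simp: X_def full)
  qed
  moreover have "X c \<noteq> 1"
    using H H1 \<open>z \<noteq> 1\<close> c(1) by (simp add: X_def)
  ultimately show ?thesis by blast
qed

section \<open>Reduced residues, orthogonality of characters and Gauss sums\<close>

definition reduced_residues :: "nat \<Rightarrow> int set" where
  "reduced_residues q = {l. l \<in> {0..<int q} \<and> coprime l (int q)}"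

lemma finite_reduced_residues [simp]: "finite (reduced_residues q)"
  by (rule finite_subset[of _ "{0..<int q}"]) (auto simp: reduced_residues_def)

text \<open>\<open>totatives q\<close> lies in \<open>(0, q]\<close> and
  \<open>reduced_residues q\<close> in \<open>[0, q)\<close>; for \<open>q > 1\<close> neither 0 nor
  \<open>q\<close> is coprime to \<open>q\<close>, so the ranges make no difference.\<close>

lemma card_reduced_residues:
  assumes "q > 1"
  shows "card (reduced_residues q) = totient q"
proof -
  have "reduced_residues q = int ` totatives q"
  proof (intro equalityI subsetI)
    fix l assume l: "l \<in> reduced_residues q"
    then obtain n where n: "l = int n"
      using nonneg_int_cases[of l] by (auto simp: reduced_residues_def)
    have "n > 0"
      using l n assms by (cases "n = 0") (auto simp: reduced_residues_def)
    then have "n \<in> totatives q"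
      using l n by (simp add: reduced_residues_def totatives_def)
    then show "l \<in> int ` totatives q"
      using n by simp
  qed (use assms totatives_less in \<open>auto simp: reduced_residues_def totatives_def\<close>)
  then show ?thesis
    by (simp add: totient_def card_image)
qed

lemma reduced_residues_cong_imp_eq:
  assumes "x \<in> reduced_residues q" "y \<in> reduced_residues q" "[x = y] (mod int q)"
  shows "x = y"
  using assms by (simp add: reduced_residues_def cong_def)

lemma mod_in_reduced_residues:
  assumes "coprime x (int q)" "q > 0"
  shows "x mod int q \<in> reduced_residues q"
  using assms by (simp add: reduced_residues_def coprime_mod_left_iff)

lemma bij_betw_mult_reduced_residues:
  assumes "coprime a (int q)" "q > 0"
  shows "bij_betw (\<lambda>l. (a * l) mod int q) (reduced_residues q) (reduced_residues q)"
proof -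
  have "inj_on (\<lambda>l. (a * l) mod int q) (reduced_residues q)"
  proof (rule inj_onI)
    fix x y assume xy: "x \<in> reduced_residues q" "y \<in> reduced_residues q"
      and "(a * x) mod int q = (a * y) mod int q"
    then have "[x = y] (mod int q)"
      using assms(1) cong_mult_lcancel[of a "int q" x y] by (simp add: cong_def)
    then show "x = y" using reduced_residues_cong_imp_eq xy by blast
  qed
  moreover have "(\<lambda>l. (a * l) mod int q) ` reduced_residues q \<subseteq> reduced_residues q"
    using assms mod_in_reduced_residues by (auto simp: reduced_residues_def)
  ultimately show ?thesis
    using endo_inj_surj[OF finite_reduced_residues] by (simp add: bij_betw_def)
qed

context
  fixes q :: nat and X :: "int \<Rightarrow> complex"
  assumes X: "dirichlet_character q X"
begin

lemma dirichlet_character_mult: "X (m * n) = X m * X n"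
  using X by (simp add: dirichlet_character_def)

lemma dirichlet_character_eq_0_iff: "X n = 0 \<longleftrightarrow> \<not> coprime n (int q)"
  using X by (auto simp: dirichlet_character_def)

lemma dirichlet_character_cong:
  assumes "[m = n] (mod int q)"
  shows "X m = X n"
proof -
  have shift: "X (n + int q * int k) = X n" for n k
  proof (induction k)
    case (Suc k)
    have "X (n + int q * int (Suc k)) = X ((n + int q * int k) + int q)"
      by (simp add: algebra_simps)
    also have "\<dots> = X n"
      using X Suc by (simp add: dirichlet_character_def)
    finally show ?case .
  qed simp
  obtain k where k: "m = n + int q * k"
    using assms by (metis cong_iff_lin cong_sym)
  show ?thesis
  proof (cases "k \<ge> 0")
    case True
    then show ?thesis using shift[of n "nat k"] k by simp
  next
    \<comment> \<open>For negative \<open>k\<close> the forward shift starts at \<open>m\<close>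
      instead.\<close>
    case False
    then show ?thesis using shift[of m "nat (- k)"] k by simp
  qed
qed

lemma dirichlet_character_1: "X 1 = 1"
proof -
  have "X 1 * X 1 = X 1"
    using dirichlet_character_mult[of 1 1] by simp
  moreover have "X 1 \<noteq> 0"
    by (simp add: dirichlet_character_eq_0_iff)
  ultimately show ?thesis by simp
qed

lemma dirichlet_character_power: "X (n ^ k) = X n ^ k"
  using dirichlet_character_1 by (induction k) (simp_all add: dirichlet_character_mult)

lemma dirichlet_character_root_of_unity:
  assumes "coprime n (int q)"
  shows "X n ^ totient q = 1"
  using dirichlet_character_cong[OF euler_theorem_int[OF assms]]
  by (simp add: dirichlet_character_power dirichlet_character_1)

text \<open>On units a character has modulus 1, so its conjugate is its inverse, which is the value
  at the inverse residue.\<close>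

lemma cnj_dirichlet_character:
  assumes "[m * n = 1] (mod int q)" "q > 0"
  shows "cnj (X n) = X m"
proof -
  have mn: "X m * X n = 1"
    using dirichlet_character_cong[OF assms(1)] dirichlet_character_1
    by (simp add: dirichlet_character_mult)
  then have "coprime n (int q)"
    using dirichlet_character_eq_0_iff[of n] by auto
  then have "norm (X n) = 1"
    using power_eq_1_iff[OF dirichlet_character_root_of_unity] assms(2) by auto
  then have "X n * cnj (X n) = 1"
    by (simp add: complex_norm_square [symmetric])
  then have "X m * (X n * cnj (X n)) = X m" by simp
  then show ?thesis
    using mn by (simp add: mult.assoc [symmetric])
qed

text \<open>Orthogonality in the residue: multiplication by a unit \<open>a\<close> with
  \<open>X a\<close> different from 1 permutes the reduced residues but multiplies the sum by
  \<open>X a\<close>.\<close>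

lemma sum_dirichlet_character:
  assumes "q > 1"
  shows "(\<Sum>l\<in>reduced_residues q. X l) = (if X = principal_character q then of_nat (totient q) else 0)"
proof (cases "X = principal_character q")
  case True
  then have "(\<Sum>l\<in>reduced_residues q. X l) = (\<Sum>l\<in>reduced_residues q. 1)"
    by (intro sum.cong) (auto simp: principal_character_def reduced_residues_def)
  then show ?thesis
    using True assms by (simp add: card_reduced_residues)
next
  case False
  then obtain a where "X a \<noteq> principal_character q a" by blast
  then have a: "coprime a (int q)" "X a \<noteq> 1"
    using dirichlet_character_eq_0_iff[of a] by (auto simp: principal_character_def split: if_splits)
  have "(\<Sum>l\<in>reduced_residues q. X l) = (\<Sum>l\<in>reduced_residues q. X ((a * l) mod int q))"
    using a assms by (intro sum.reindex_bij_betw[symmetric] bij_betw_mult_reduced_residues) auto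
  also have "\<dots> = (\<Sum>l\<in>reduced_residues q. X a * X l)"
    by (intro sum.cong refl) (metis cong_mod_left cong_refl dirichlet_character_cong dirichlet_character_mult)
  also have "\<dots> = X a * (\<Sum>l\<in>reduced_residues q. X l)"
    by (simp add: sum_distrib_left)
  finally show ?thesis using a False by auto
qed

end

text \<open>A character is determined by one period, where each value is 0 or one of finitely many
  roots of unity.\<close>

lemma finite_dirichlet_characters:
  assumes "q > 0"
  shows "finite {X. dirichlet_character q X}"
proof (rule finite_imageD)
  let ?B = "insert 0 {z::complex. z ^ totient q = 1}"
  have "(\<lambda>X. restrict X {0..<int q}) ` {X. dirichlet_character q X} \<subseteq> (\<Pi>\<^sub>E l\<in>{0..<int q}. ?B)"
    using dirichlet_character_root_of_unity dirichlet_character_eq_0_iff by fastforce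
  moreover have "finite {z::complex. z ^ totient q = 1}"
    using assms by (intro finite_roots_unity) (simp add: Suc_le_eq)
  then have "finite (\<Pi>\<^sub>E l\<in>{0..<int q}. ?B)"
    by (intro finite_PiE) auto
  ultimately show "finite ((\<lambda>X. restrict X {0..<int q}) ` {X. dirichlet_character q X})"
    by (rule finite_subset)
  show "inj_on (\<lambda>X. restrict X {0..<int q}) {X. dirichlet_character q X}"
  proof (rule inj_onI, clarify)
    fix X Y assume XY: "dirichlet_character q X" "dirichlet_character q Y"
      and eq: "restrict X {0..<int q} = restrict Y {0..<int q}"
    show "X = Y"
    proof
      fix n
      have c: "[n = n mod int q] (mod int q)" by (simp add: cong_def)
      have "n mod int q \<in> {0..<int q}" using assms by simp
      then have "X (n mod int q) = Y (n mod int q)"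
        using fun_cong[OF eq, of "n mod int q"] by (simp only: restrict_apply' )
      then show "X n = Y n"
        using dirichlet_character_cong[OF XY(1) c] dirichlet_character_cong[OF XY(2) c] by simp
    qed
  qed
qed

lemma dirichlet_character_principal: "dirichlet_character q (principal_character q)"
proof -
  have "coprime (n + int q) (int q) \<longleftrightarrow> coprime n (int q)" for n
    by (simp add: coprime_iff_gcd_eq_1)
  then show ?thesis
    by (auto simp: dirichlet_character_def principal_character_def)
qed

text \<open>The dual orthogonality argument: multiplication by a character \<open>Y\<close> with
  \<open>Y c\<close> different from 1 permutes the characters but multiplies the sum by
  \<open>Y c\<close>. The separation lemma supplies \<open>Y\<close>.\<close>

lemma sum_over_characters_not_1:
  assumes "q > 0" "coprime c (int q)" "\<not> [c = 1] (mod int q)"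
  shows "(\<Sum>X | dirichlet_character q X. X c) = 0"
proof -
  let ?D = "{X. dirichlet_character q X}"
  obtain Y where Y: "dirichlet_character q Y" "Y c \<noteq> 1"
    using dirichlet_character_separates[OF assms(2,3,1)] by blast
  let ?m = "\<lambda>X n. Y n * X n"
  have "?m ` ?D \<subseteq> ?D"
    using Y(1) by (auto simp: dirichlet_character_def)
  moreover have "inj_on ?m ?D"
  proof (rule inj_onI, rule ext)
    fix X X' n
    assume X: "X \<in> ?D" "X' \<in> ?D" and eq: "(\<lambda>n. Y n * X n) = (\<lambda>n. Y n * X' n)"
    show "X n = X' n"
    proof (cases "coprime n (int q)")
      case True
      then show ?thesis
        using fun_cong[OF eq, of n] dirichlet_character_eq_0_iff[OF Y(1), of n] by simp
    next
      case False
      then show ?thesis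
        using X dirichlet_character_eq_0_iff[of q X n] dirichlet_character_eq_0_iff[of q X' n] by simp
    qed
  qed
  ultimately have "bij_betw ?m ?D ?D"
    using endo_inj_surj[OF finite_dirichlet_characters[OF assms(1)]] by (simp add: bij_betw_def)
  then have "(\<Sum>X\<in>?D. ?m X c) = (\<Sum>X\<in>?D. X c)"
    using sum.reindex_bij_betw[of ?m ?D ?D "\<lambda>X. X c"] by simp
  then have "Y c * (\<Sum>X\<in>?D. X c) = (\<Sum>X\<in>?D. X c)"
    by (simp add: sum_distrib_left)
  then show ?thesis using Y(2) by simp
qed

text \<open>Double counting \<open>X l\<close> over all characters and reduced residues determines the number of
  characters.\<close>

lemma sum_over_characters:
  assumes "q > 1" "coprime c (int q)"
  shows "(\<Sum>X | dirichlet_character q X. X c) = (if [c = 1] (mod int q) then of_nat (totient q) else 0)"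
proof (cases "[c = 1] (mod int q)")
  case True
  let ?D = "{X. dirichlet_character q X}" and ?R = "reduced_residues q"
  have fin: "finite ?D" using finite_dirichlet_characters assms by simp
  have one: "1 \<in> ?R" using assms by (simp add: reduced_residues_def)
  have "(\<Sum>X\<in>?D. X c) = (\<Sum>X\<in>?D. X 1)"
    using dirichlet_character_cong True by (intro sum.cong) auto
  also have "\<dots> = (\<Sum>l\<in>?R. if l = 1 then \<Sum>X\<in>?D. X 1 else 0)"
    using one by simp
  \<comment> \<open>The sum over \<open>l\<close> can be completed because the character sums at
    residues other than 1 already vanish.\<close>
  also have "\<dots> = (\<Sum>l\<in>?R. \<Sum>X\<in>?D. X l)"
  proof (intro sum.cong refl)
    fix l assume l: "l \<in> ?R"
    show "(if l = 1 then \<Sum>X\<in>?D. X 1 else 0) = (\<Sum>X\<in>?D. X l)"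
    proof (cases "l = 1")
      case False
      then have "\<not> [l = 1] (mod int q)"
        using reduced_residues_cong_imp_eq[OF l one] by blast
      then show ?thesis
        using False assms l sum_over_characters_not_1[of q l] by (simp add: reduced_residues_def)
    qed simp
  qed
  also have "\<dots> = (\<Sum>X\<in>?D. if X = principal_character q then of_nat (totient q) else 0)"
    using assms sum_dirichlet_character by (subst sum.swap) (intro sum.cong, auto)
  also have "\<dots> = of_nat (totient q)"
    using fin dirichlet_character_principal by simp
  finally show ?thesis using True by simp
next
  case False
  then show ?thesis using sum_over_characters_not_1 assms by simp
qed

text \<open>Fourier inversion on the units: \<open>cnj (X b)\<close> is the value of
  \<open>X\<close> at the inverse \<open>b'\<close> of \<open>b\<close>, so summing over the
  characters first isolates the one residue \<open>l\<close> congruent to \<open>b\<close>.\<close>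

lemma sum_gauss_sum_cnj:
  assumes "q > 1" "coprime b (int q)"
  shows "(\<Sum>X | dirichlet_character q X. gauss_sum q X * cnj (X b)) = of_nat (totient q) * expq q b"
proof -
  let ?D = "{X. dirichlet_character q X}" and ?R = "reduced_residues q"
  obtain b' where b': "[b * b' = 1] (mod int q)"
    using cong_solve_coprime_int[OF assms(2)] by blast
  have cop: "coprime b' (int q)"
    using b' coprime_iff_invertible_int[of b' "int q"] by (auto simp: mult.commute)
  have "gauss_sum q X * cnj (X b) = (\<Sum>l\<in>?R. X (l * b') * expq q l)" if "X \<in> ?D" for X
  proof -
    have X: "dirichlet_character q X" using that by simp
    have "gauss_sum q X = (\<Sum>l\<in>?R. X l * expq q l)"
      unfolding gauss_sum_def
      by (rule sum.mono_neutral_right) (auto simp: reduced_residues_def dirichlet_character_eq_0_iff[OF X])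
    moreover have "cnj (X b) = X b'"
      using b' assms by (intro cnj_dirichlet_character[OF X]) (simp_all add: mult.commute)
    ultimately show ?thesis
      by (simp add: sum_distrib_left dirichlet_character_mult[OF X] mult_ac)
  qed
  then have "(\<Sum>X\<in>?D. gauss_sum q X * cnj (X b)) = (\<Sum>X\<in>?D. \<Sum>l\<in>?R. X (l * b') * expq q l)"
    by (intro sum.cong) auto
  also have "\<dots> = (\<Sum>l\<in>?R. (\<Sum>X\<in>?D. X (l * b')) * expq q l)"
    by (subst sum.swap) (simp add: sum_distrib_right)
  also have "\<dots> = (\<Sum>l\<in>?R. if l = b mod int q then of_nat (totient q) * expq q l else 0)"
  proof (intro sum.cong refl)
    fix l assume l: "l \<in> ?R"
    have "[l * b' = 1] (mod int q) \<longleftrightarrow> [l * b' = b * b'] (mod int q)"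
      using b' cong_sym cong_trans by blast
    also have "\<dots> \<longleftrightarrow> [l = b] (mod int q)"
      using cop by (simp add: cong_mult_rcancel)
    also have "\<dots> \<longleftrightarrow> l = b mod int q"
      using l by (auto simp: reduced_residues_def cong_def)
    finally show "(\<Sum>X\<in>?D. X (l * b')) * expq q l = (if l = b mod int q then of_nat (totient q) * expq q l else 0)"
      using l cop assms by (simp add: sum_over_characters reduced_residues_def)
  qed
  also have "\<dots> = of_nat (totient q) * expq q (b mod int q)"
    using mod_in_reduced_residues[of b q] assms by simp
  also have "expq q (b mod int q) = expq q b"
    using assms by (intro expq_cong) simp_all
  finally show ?thesis .
qed

lemma gauss_sum_principal:
  assumes "q > 0"
  shows "gauss_sum q (principal_character q) = of_int (moebius_mu q)"
proof -
  have "gauss_sum q (principal_character q) = (\<Sum>l | l \<in> {0..<int q} \<and> coprime l (int q). expq q l)"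
    unfolding gauss_sum_def principal_character_def
    by (rule sum.mono_neutral_cong_right) auto
  then show ?thesis
    using ramanujan_sum_one[OF assms] by simp
qed

subsection \<open>The Euler product\<close>

text \<open>The series is the expansion of \<open>- ln (1 - z)\<close>; comparison with the
  geometric series gives absolute convergence and hence the unordered sum.\<close>

lemma exp_log_series:
  fixes z :: complex
  assumes "norm z < 1"
  shows "exp (\<Sum>\<^sub>\<infinity>k\<in>{1::nat..}. z ^ k / of_nat k) = 1 / (1 - z)"
proof -
  have "(\<lambda>k. - (z ^ k / of_nat k)) sums ln (1 - z)"
    using Ln_series'[of "- z"] assms by simp
  then have "(\<lambda>k. z ^ k / of_nat k) sums (- ln (1 - z))"
    using sums_minus by fastforce
  moreover have "summable (\<lambda>k. norm (z ^ k / of_nat k))"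
  proof (rule summable_comparison_test')
    show "summable (\<lambda>k. norm z ^ k)"
      using assms by (intro summable_geometric) simp
    show "norm (norm (z ^ k / of_nat k)) \<le> norm z ^ k" for k
    proof (cases "k = 0")
      case False
      then have "norm z ^ k / real k \<le> norm z ^ k / 1"
        by (intro divide_left_mono) auto
      then show ?thesis by (simp add: norm_divide norm_power)
    qed simp
  qed
  ultimately have "((\<lambda>k. z ^ k / of_nat k) has_sum (- ln (1 - z))) UNIV"
    by (rule norm_summable_imp_has_sum[rotated])
  then have "((\<lambda>k. z ^ k / of_nat k) has_sum (- ln (1 - z))) {1..}"
    by (rule has_sum_cong_neutral[THEN iffD1, rotated -1]) (auto simp: not_le)
  moreover have "z \<noteq> 1" using assms by auto
  ultimately show ?thesis
    by (simp add: infsumI exp_minus divide_inverse)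
qed

context
  fixes f :: "nat \<Rightarrow> complex"
  assumes f_1: "f 1 = 1"
    and f_mult: "\<And>m n. m > 0 \<Longrightarrow> n > 0 \<Longrightarrow> f (m * n) = f m * f n"
    and f_summable: "(\<lambda>n. norm (f n)) summable_on {1..}"
begin

lemma completely_multiplicative_power: "m > 0 \<Longrightarrow> f (m ^ k) = f m ^ k"
  using f_1 by (induction k) (simp_all add: f_mult)

text \<open>Along the powers of \<open>p\<close> the summable family of norms is a geometric series,
  whose ratio must therefore be less than 1.\<close>

lemma norm_completely_multiplicative_prime:
  assumes "prime p"
  shows "norm (f p) < 1"
proof -
  have "inj (\<lambda>k. p ^ k)"
    using assms prime_gt_1_nat by (auto intro!: inj_onI)
  moreover have "(\<lambda>n. norm (f n)) summable_on range (\<lambda>k. p ^ k)"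
    using f_summable by (rule summable_on_subset_banach) (use assms in \<open>auto simp: prime_gt_0_nat Suc_le_eq\<close>)
  ultimately have "((\<lambda>n. norm (f n)) \<circ> (\<lambda>k. p ^ k)) summable_on UNIV"
    by (simp add: summable_on_reindex)
  then have "summable ((\<lambda>n. norm (f n)) \<circ> (\<lambda>k. p ^ k))"
    by (rule summable_on_imp_summable)
  also have "(\<lambda>n. norm (f n)) \<circ> (\<lambda>k. p ^ k) = (\<lambda>k. norm (f p) ^ k)"
    using assms by (auto simp: fun_eq_iff completely_multiplicative_power prime_gt_0_nat norm_power)
  finally show ?thesis by (simp add: summable_geometric_iff)
qed

text \<open>When \<open>p\<close> joins \<open>P\<close>, each admissible number is uniquely
  \<open>n * p ^ k\<close> with the prime factors of \<open>n\<close> in the old \<open>P\<close>,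
  so the sum gains a geometric series in \<open>f p\<close> as a factor.\<close>

lemma infsum_smooth:
  assumes "finite P" "\<And>p. p \<in> P \<Longrightarrow> prime p"
  shows "infsum f {n. n > 0 \<and> prime_factors n \<subseteq> P} = (\<Prod>p\<in>P. 1 / (1 - f p))"
  using assms
proof (induction P rule: finite_induct)
  case empty
  have "{n::nat. n > 0 \<and> prime_factors n \<subseteq> {}} = {1}"
    by (auto simp: prime_factorization_empty_iff)
  then show ?case using f_1 by simp
next
  case (insert p P)
  let ?S = "\<lambda>P. {n::nat. n > 0 \<and> prime_factors n \<subseteq> P}"
  have p: "prime p" "p > 0" using insert.prems by (auto simp: prime_gt_0_nat)
  have bij: "bij_betw (\<lambda>(n, k). n * p ^ k) (?S P \<times> UNIV) (?S (insert p P))"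
  \<comment> \<open>The inverse map splits off the full power of \<open>p\<close>.\<close>
  proof (rule bij_betw_byWitness[where f' = "\<lambda>m. (m div p ^ multiplicity p m, multiplicity p m)"])
    show "\<forall>x\<in>?S P \<times> UNIV. (\<lambda>m. (m div p ^ multiplicity p m, multiplicity p m))
        ((\<lambda>(n, k). n * p ^ k) x) = x"
    proof
      fix x assume "x \<in> ?S P \<times> (UNIV :: nat set)"
      then obtain n k where x: "x = (n, k)" and n: "n > 0" "prime_factors n \<subseteq> P"
        by auto
      then have "\<not> p dvd n"
        using insert.hyps(2) p by (auto simp: in_prime_factors_iff)
      then have "multiplicity p (n * p ^ k) = k"
        using n p by (simp add: prime_elem_multiplicity_mult_distrib not_dvd_imp_multiplicity_0)
      then show "(\<lambda>m. (m div p ^ multiplicity p m, multiplicity p m)) ((\<lambda>(n, k). n * p ^ k) x) = x"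
        using p x by simp
    qed
    show "\<forall>m\<in>?S (insert p P). (\<lambda>(n, k). n * p ^ k) (m div p ^ multiplicity p m, multiplicity p m) = m"
      by (auto simp: multiplicity_dvd)
    show "(\<lambda>(n, k). n * p ^ k) ` (?S P \<times> UNIV) \<subseteq> ?S (insert p P)"
      using p(2) primes_dvd_imp_eq[OF _ p(1)]
      by (auto simp: in_prime_factors_iff prime_dvd_mult_iff prime_dvd_power_iff subset_iff)
        (meson prime_dvd_power)
    show "(\<lambda>m. (m div p ^ multiplicity p m, multiplicity p m)) ` ?S (insert p P) \<subseteq> ?S P \<times> UNIV"
    proof clarsimp
      fix m :: nat assume m: "0 < m" "prime_factors m \<subseteq> insert p P"
      define n where "n = m div p ^ multiplicity p m"
      have mn: "m = n * p ^ multiplicity p m"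
        by (simp add: n_def multiplicity_dvd)
      have n0: "n > 0" using mn m by (metis gr0I mult_0)
      have "\<not> p dvd n"
        unfolding n_def using m p by (intro multiplicity_decompose) auto
      moreover have "prime_factors n \<subseteq> prime_factors m"
        using mn m by (intro dvd_prime_factors) (metis less_not_refl, metis dvd_triv_left)
      ultimately show "0 < m div p ^ multiplicity p m \<and> prime_factors (m div p ^ multiplicity p m) \<subseteq> P"
        using m n0 unfolding n_def[symmetric] by (auto simp: in_prime_factors_iff subset_iff)
    qed
  qed
  have summable: "f summable_on ?S (insert p P)"
    using f_summable by (rule abs_summable_summable[OF summable_on_subset_banach]) auto
  have eq: "f (case x of (n, k) \<Rightarrow> n * p ^ k) = (case x of (n, k) \<Rightarrow> f n * f p ^ k)"
    if "x \<in> ?S P \<times> UNIV" for x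
    using that p by (auto simp: f_mult completely_multiplicative_power)
  have "(\<lambda>x. f (case x of (n, k) \<Rightarrow> n * p ^ k)) summable_on ?S P \<times> UNIV"
    using summable by (subst summable_on_reindex_bij_betw[OF bij])
  then have "(\<lambda>(n, k). f n * f p ^ k) summable_on ?S P \<times> UNIV"
    by (subst (asm) summable_on_cong[OF eq])
  from infsum_Sigma'_banach[OF this]
  have "(\<Sum>\<^sub>\<infinity>n\<in>?S P. \<Sum>\<^sub>\<infinity>k. f n * f p ^ k) = (\<Sum>\<^sub>\<infinity>(n, k)\<in>?S P \<times> UNIV. f n * f p ^ k)" .
  also have "\<dots> = infsum f (?S (insert p P))"
    by (subst infsum_reindex_bij_betw[OF bij, symmetric]) (intro infsum_cong eq[symmetric])
  finally have "infsum f (?S (insert p P)) = (\<Sum>\<^sub>\<infinity>n\<in>?S P. \<Sum>\<^sub>\<infinity>k. f n * f p ^ k)" ..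
  also have "(\<lambda>n. \<Sum>\<^sub>\<infinity>k. f n * f p ^ k) = (\<lambda>n. f n * (1 / (1 - f p)))"
  proof
    fix n
    have "((\<lambda>k. f p ^ k) has_sum (1 / (1 - f p))) UNIV"
      using norm_completely_multiplicative_prime[OF p(1)]
      by (intro norm_summable_imp_has_sum geometric_sums) (simp_all add: norm_power)
    then have "((\<lambda>k. f n * f p ^ k) has_sum (f n * (1 / (1 - f p)))) UNIV"
      by (rule has_sum_cmult_right)
    then show "(\<Sum>\<^sub>\<infinity>k. f n * f p ^ k) = f n * (1 / (1 - f p))"
      by (rule infsumI)
  qed
  also have "(\<Sum>\<^sub>\<infinity>n\<in>?S P. f n * (1 / (1 - f p))) = infsum f (?S P) * (1 / (1 - f p))"
    by (rule infsum_cmult_left')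
  also have "\<dots> = (\<Prod>p\<in>insert p P. 1 / (1 - f p))"
    using insert by simp
  finally show ?case .
qed

text \<open>A finite set \<open>F\<close> carries the sum of the norms up to \<open>e / 2\<close>.
  Once \<open>P\<close> contains all prime factors of the elements of \<open>F\<close>, every
  missing term lies outside \<open>F\<close>.\<close>

lemma tendsto_infsum_smooth:
  "((\<lambda>P. infsum f {n. n > 0 \<and> prime_factors n \<subseteq> P}) \<longlongrightarrow> infsum f {1..})
     (finite_subsets_at_top {p. prime p})"
proof (rule tendstoI)
  fix e :: real assume e: "e > 0"
  let ?S = "\<lambda>P. {n::nat. n > 0 \<and> prime_factors n \<subseteq> P}"
  let ?g = "\<lambda>n. norm (f n)"
  obtain F where F: "finite F" "F \<subseteq> {1..}" "dist (sum ?g F) (infsum ?g {1..}) \<le> e / 2"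
    using has_sum_finite_approximation[OF has_sum_infsum[OF f_summable], of "e / 2"] e by auto
  let ?Q = "\<Union>n\<in>F. prime_factors n"
  have "dist (infsum f (?S P)) (infsum f {1..}) < e" if P: "?Q \<subseteq> P" for P
  proof -
    have sub: "F \<subseteq> ?S P" "?S P \<subseteq> {1..}" using P F(2) by auto
    have fs: "f summable_on A" "?g summable_on A" if "A \<subseteq> {1..}" for A
      using summable_on_subset_banach[OF f_summable that] abs_summable_summable by blast+
    have "infsum f {1..} - infsum f (?S P) = infsum f ({1..} - ?S P)"
      using fs sub by (intro infsum_Diff[symmetric]) auto
    then have "dist (infsum f (?S P)) (infsum f {1..}) = norm (infsum f ({1..} - ?S P))"
      by (simp add: dist_norm norm_minus_commute)
    also have "\<dots> \<le> infsum ?g ({1..} - ?S P)"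
      by (intro norm_infsum_bound fs) auto
    also have "\<dots> \<le> infsum ?g ({1..} - F)"
      using sub by (intro infsum_mono_neutral fs) auto
    also have "\<dots> = infsum ?g {1..} - sum ?g F"
      using fs F by (subst infsum_Diff) auto
    also have "\<dots> \<le> e / 2"
      using F(3) unfolding dist_real_def by linarith
    also have "\<dots> < e" using e by simp
    finally show ?thesis .
  qed
  moreover have "finite ?Q" "?Q \<subseteq> {p. prime p}" using F by auto
  ultimately show "\<forall>\<^sub>F P in finite_subsets_at_top {p. prime p}.
      dist (infsum f (?S P)) (infsum f {1..}) < e"
    unfolding eventually_finite_subsets_at_top by (intro exI[of _ ?Q]) blast
qed

text \<open>The exponentials of the finite sums of logarithms are the finite Euler products, hence
  the sums over smooth numbers; the two limits agree by uniqueness. The exponential form avoids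
  choosing a logarithm of the left-hand side.\<close>

theorem euler_product_exp:
  assumes "(\<lambda>p. \<Sum>\<^sub>\<infinity>k\<in>{1::nat..}. f p ^ k / of_nat k) summable_on {p. prime p}"
  shows "infsum f {1..} = exp (\<Sum>\<^sub>\<infinity>p\<in>{p. prime p}. \<Sum>\<^sub>\<infinity>k\<in>{1::nat..}. f p ^ k / of_nat k)"
proof -
  let ?l = "\<lambda>p. \<Sum>\<^sub>\<infinity>k\<in>{1::nat..}. f p ^ k / of_nat k"
  have "((\<lambda>P. exp (sum ?l P)) \<longlongrightarrow> exp (infsum ?l {p. prime p})) (finite_subsets_at_top {p. prime p})"
    using assms by (intro tendsto_exp infsum_tendsto)
  moreover have "\<forall>\<^sub>F P in finite_subsets_at_top {p. prime p}.
      exp (sum ?l P) = infsum f {n. n > 0 \<and> prime_factors n \<subseteq> P}"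
  proof (rule eventually_finite_subsets_at_top_weakI)
    fix P :: "nat set" assume P: "finite P" "P \<subseteq> {p. prime p}"
    then have "exp (sum ?l P) = (\<Prod>p\<in>P. 1 / (1 - f p))"
      by (simp add: exp_sum) (intro prod.cong refl exp_log_series[simplified] norm_completely_multiplicative_prime, auto)
    also have "\<dots> = infsum f {n. n > 0 \<and> prime_factors n \<subseteq> P}"
      using P by (intro infsum_smooth[symmetric]) auto
    finally show "exp (sum ?l P) = infsum f {n. n > 0 \<and> prime_factors n \<subseteq> P}" .
  qed
  ultimately have "((\<lambda>P. infsum f {n. n > 0 \<and> prime_factors n \<subseteq> P}) \<longlongrightarrow>
      exp (infsum ?l {p. prime p})) (finite_subsets_at_top {p. prime p})"
    by (rule Lim_transform_eventually)
  then show ?thesis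
    using tendsto_unique[OF finite_subsets_at_top_neq_bot tendsto_infsum_smooth] by blast
qed

end

subsection \<open>Series over prime powers\<close>

lemma sum_count_mult:
  fixes M :: "nat multiset"
  assumes "finite S" "set_mset M \<subseteq> S"
  shows "(\<Sum>x\<in>S. count M x * x) = sum_mset M"
  using assms(2)
proof (induction M)
  case (add y M)
  have "(\<Sum>x\<in>S. count (add_mset y M) x * x) = (\<Sum>x\<in>S. count M x * x + (if x = y then y else 0))"
    by (intro sum.cong) auto
  also have "\<dots> = (\<Sum>x\<in>S. count M x * x) + y"
    using add.prems assms(1) by (simp add: sum.distrib)
  finally show ?case using add by simp
qed simp

text \<open>In this form complete additivity is immediate, since the factorization multiset of a
  product is the sum of those of its factors.\<close>

lemma A_fun_eq_sum_mset: "A_fun n = sum_mset (prime_factorization n)"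
proof -
  have "A_fun n = (\<Sum>p\<in>set_mset (prime_factorization n). count (prime_factorization n) p * p)"
    unfolding A_fun_def by (intro sum.cong refl) (simp add: count_prime_factorization in_prime_factors_iff)
  also have "\<dots> = sum_mset (prime_factorization n)"
    by (rule sum_count_mult) simp_all
  finally show ?thesis .
qed

lemma A_fun_mult: "m > 0 \<Longrightarrow> n > 0 \<Longrightarrow> A_fun (m * n) = A_fun m + A_fun n"
  by (simp add: A_fun_eq_sum_mset prime_factorization_mult)

lemma A_fun_prime: "prime p \<Longrightarrow> A_fun p = p"
  by (simp add: A_fun_eq_sum_mset prime_factorization_prime)

lemma of_nat_powr_mult_nat:
  assumes "p > 0"
  shows "(of_nat p :: complex) powr (of_nat k * s) = (of_nat p powr s) ^ k"
  using assms by (simp add: powr_def exp_of_nat_mult [symmetric] mult_ac)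

text \<open>A single sum over pairs, linear in the coefficients \<open>c\<close> whenever it
  converges absolutely; all logarithms in the theorem are expressed through it.\<close>

definition prime_powers_sum :: "complex \<Rightarrow> (nat \<Rightarrow> nat \<Rightarrow> complex) \<Rightarrow> complex" where
  "prime_powers_sum s c =
     (\<Sum>\<^sub>\<infinity>(p, k)\<in>{p. prime p} \<times> {1..}. c p k / (of_nat k * of_nat p powr (of_nat k * s)))"

text \<open>Sufficient for absolute convergence when \<open>Re s > 1\<close>, and stable under
  finite linear combinations.\<close>

definition bounded_coeff :: "(nat \<Rightarrow> nat \<Rightarrow> complex) \<Rightarrow> bool" where
  "bounded_coeff c \<longleftrightarrow> (\<exists>C. \<forall>p k. norm (c p k) \<le> C)"

lemma bounded_coeffI: "(\<And>p k. norm (c p k) \<le> C) \<Longrightarrow> bounded_coeff c"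
  unfolding bounded_coeff_def by blast

lemma bounded_coeff_cmult:
  assumes "bounded_coeff c"
  shows "bounded_coeff (\<lambda>p k. a * c p k)"
proof -
  obtain C where "\<And>p k. norm (c p k) \<le> C" using assms unfolding bounded_coeff_def by blast
  then have "norm (a * c p k) \<le> norm a * C" for p k
    by (simp add: norm_mult mult_left_mono)
  then show ?thesis by (rule bounded_coeffI)
qed

lemma bounded_coeff_add:
  assumes "bounded_coeff c" "bounded_coeff d"
  shows "bounded_coeff (\<lambda>p k. c p k + d p k)"
proof -
  obtain C D where "\<And>p k. norm (c p k) \<le> C" "\<And>p k. norm (d p k) \<le> D"
    using assms unfolding bounded_coeff_def by blast
  then have "norm (c p k + d p k) \<le> C + D" for p k
    by (meson norm_triangle_mono)
  then show ?thesis by (rule bounded_coeffI)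
qed

lemma bounded_coeff_sum:
  assumes "finite I" "\<And>i. i \<in> I \<Longrightarrow> bounded_coeff (c i)"
  shows "bounded_coeff (\<lambda>p k. \<Sum>i\<in>I. c i p k)"
  using assms
proof (induction I rule: finite_induct)
  case empty
  show ?case by (rule bounded_coeffI[of _ 0]) simp
next
  case (insert i I)
  then show ?case by (simp add: bounded_coeff_add)
qed

section \<open>Absolute convergence, linearity and the logarithms as prime power sums\<close>

context
  fixes s :: complex
  assumes s: "Re s > 1"
begin

lemma summable_on_norm_powr: "(\<lambda>n. norm (of_nat n powr (- s) :: complex)) summable_on A"
proof -
  have "(\<lambda>n. norm (of_nat n powr (- s) :: complex)) = (\<lambda>n. real n powr (- Re s))"
    by (simp add: norm_powr_real_powr)
  moreover have "summable (\<lambda>n. real n powr (- Re s))"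
    using s by (simp add: summable_real_powr_iff)
  ultimately have "(\<lambda>n. norm (of_nat n powr (- s) :: complex)) summable_on UNIV"
    by (intro summable_nonneg_imp_summable_on) auto
  then show ?thesis
    by (rule summable_on_subset_banach) simp
qed

text \<open>Distinct pairs give distinct prime powers, so up to a constant the terms are dominated
  by a subfamily of the convergent series of \<open>n powr (- Re s)\<close>.\<close>

lemma summable_on_prime_powers:
  assumes "bounded_coeff c"
  shows "(\<lambda>(p, k). c p k / (of_nat k * of_nat p powr (of_nat k * s))) summable_on {p. prime p} \<times> {1..}"
proof -
  let ?I = "{p::nat. prime p} \<times> {1::nat..}"
  let ?b = "\<lambda>n. norm (of_nat n powr (- s) :: complex)"
  obtain C where C: "\<And>p k. norm (c p k) \<le> C" using assms unfolding bounded_coeff_def by blast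
  have inj: "inj_on (\<lambda>(p, k). p ^ k) ?I"
  proof (rule inj_onI)
    fix x y assume xy: "x \<in> ?I" "y \<in> ?I" "(\<lambda>(p, k). p ^ k) x = (\<lambda>(p, k). p ^ k) y"
    obtain p k r l where eq: "x = (p, k)" "y = (r, l)" by (metis surj_pair)
    show "x = y"
      using xy prime_power_inj'[of p r k l] by (simp add: eq)
  qed
  then have "(?b \<circ> (\<lambda>(p, k). p ^ k)) summable_on ?I"
    using summable_on_norm_powr by (simp only: summable_on_reindex[OF inj, symmetric])
  then have summable: "(\<lambda>x. C * (?b \<circ> (\<lambda>(p, k). p ^ k)) x) summable_on ?I"
    by (rule summable_on_cmult_right)
  have "(\<lambda>x. norm (case x of (p, k) \<Rightarrow> c p k / (of_nat k * of_nat p powr (of_nat k * s)))) summable_on ?I"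
  proof (rule Infinite_Sum.abs_summable_on_comparison_test'[OF summable])
    fix x assume "x \<in> ?I"
    then obtain p k where x: "x = (p, k)" and pk: "p > 0" "k \<ge> 1"
      by (auto simp: prime_gt_0_nat)
    have *: "norm (of_nat p powr (of_nat k * s) :: complex) = real p powr (real k * Re s)"
      by (simp add: norm_powr_real_powr)
    have "?b (p ^ k) = real (p ^ k) powr (- Re s)"
      by (simp only: norm_powr_real_powr[OF Reals_of_nat] complex_Re_of_nat of_nat_0_le_iff uminus_complex.sel)
    then have "?b (p ^ k) = 1 / real p powr (real k * Re s)"
      using pk by (simp add: powr_minus divide_inverse powr_powr flip: powr_realpow)
    moreover have "norm (c p k) / (real k * real p powr (real k * Re s)) \<le> C / (1 * real p powr (real k * Re s))"
      using pk C by (intro frac_le mult_right_mono) (auto intro: order_trans[OF norm_ge_zero C])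
    ultimately show "norm (case x of (p, k) \<Rightarrow> c p k / (of_nat k * of_nat p powr (of_nat k * s)))
        \<le> C * (?b \<circ> (\<lambda>(p, k). p ^ k)) x"
      by (simp add: x norm_divide norm_mult *)
  qed
  then show ?thesis by (rule abs_summable_summable)
qed

lemma
  assumes "bounded_coeff c"
  shows infsum_primes_powers: "(\<Sum>\<^sub>\<infinity>p\<in>{p. prime p}. \<Sum>\<^sub>\<infinity>k\<in>{1..}.
      c p k / (of_nat k * of_nat p powr (of_nat k * s))) = prime_powers_sum s c"
    and summable_on_primes: "(\<lambda>p. \<Sum>\<^sub>\<infinity>k\<in>{1..}.
      c p k / (of_nat k * of_nat p powr (of_nat k * s))) summable_on {p. prime p}"
  using infsum_Sigma'_banach[OF summable_on_prime_powers[OF assms]]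
    summable_on_Sigma_banach[OF summable_on_prime_powers[OF assms]]
  by (simp_all add: prime_powers_sum_def)

lemma prime_powers_sum_cmult:
  "prime_powers_sum s (\<lambda>p k. a * c p k) = a * prime_powers_sum s c"
  unfolding prime_powers_sum_def
  by (subst infsum_cmult_right'[symmetric]) (intro infsum_cong, auto)

lemma prime_powers_sum_add:
  assumes "bounded_coeff c" "bounded_coeff d"
  shows "prime_powers_sum s (\<lambda>p k. c p k + d p k) = prime_powers_sum s c + prime_powers_sum s d"
  unfolding prime_powers_sum_def
  by (subst infsum_add[OF assms[THEN summable_on_prime_powers], symmetric])
    (intro infsum_cong, auto simp: add_divide_distrib)

lemma prime_powers_sum_sum:
  assumes "finite I" "\<And>i. i \<in> I \<Longrightarrow> bounded_coeff (c i)"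
  shows "prime_powers_sum s (\<lambda>p k. \<Sum>i\<in>I. c i p k) = (\<Sum>i\<in>I. prime_powers_sum s (c i))"
  using assms
proof (induction I rule: finite_induct)
  case empty
  show ?case by (simp add: prime_powers_sum_def case_prod_unfold)
next
  case (insert i I)
  then show ?case by (simp add: prime_powers_sum_add bounded_coeff_sum)
qed

lemma prime_powers_sum_cong:
  assumes "\<And>p k. prime p \<Longrightarrow> k \<ge> 1 \<Longrightarrow> c p k = d p k"
  shows "prime_powers_sum s c = prime_powers_sum s d"
  unfolding prime_powers_sum_def using assms by (intro infsum_cong) auto

text \<open>Extends the sum to all primes with zero coefficients away from \<open>q\<close>, so that
  it can be combined with the other series term by term.\<close>

lemma sum_prime_factors_powers:
  assumes "bounded_coeff c"
  shows "(\<Sum>p\<in>prime_factors q. \<Sum>\<^sub>\<infinity>k\<in>{1..}. c p k / (of_nat k * of_nat p powr (s * of_nat k))) =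
    prime_powers_sum s (\<lambda>p k. if p \<in> prime_factors q then c p k else 0)"
proof -
  let ?c = "\<lambda>p k. if p \<in> prime_factors q then c p k else 0"
  obtain C where "\<And>p k. norm (c p k) \<le> C" using assms unfolding bounded_coeff_def by blast
  then have "norm (?c p k) \<le> C" for p k
    using order_trans[OF norm_ge_zero] by auto
  then have "bounded_coeff ?c" by (rule bounded_coeffI)
  then have "prime_powers_sum s ?c =
      (\<Sum>\<^sub>\<infinity>p\<in>{p. prime p}. \<Sum>\<^sub>\<infinity>k\<in>{1..}. ?c p k / (of_nat k * of_nat p powr (of_nat k * s)))"
    by (rule infsum_primes_powers[symmetric])
  also have "\<dots> = (\<Sum>\<^sub>\<infinity>p\<in>prime_factors q. \<Sum>\<^sub>\<infinity>k\<in>{1..}.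
      c p k / (of_nat k * of_nat p powr (s * of_nat k)))"
    by (intro infsum_cong_neutral) (auto simp: mult.commute)
  finally show ?thesis by simp
qed

text \<open>The Euler product applies because \<open>A_fun\<close> is completely additive. The
  \<open>k\<close>-th power of \<open>psi h q p\<close> has \<open>p * k\<close> in its exponent,
  not \<open>p ^ k\<close>.\<close>

lemma L_psi_eq_exp:
  "L_psi h q s = exp (prime_powers_sum s (\<lambda>p k. expq q (h * int p * int k)))"
proof -
  let ?f = "\<lambda>n. psi h q n * of_nat n powr (- s)"
  let ?c = "\<lambda>p k. expq q (h * int p * int k)"
  have bd: "bounded_coeff ?c" by (rule bounded_coeffI[of _ 1]) simp
  have eq: "?f p ^ k / of_nat k = ?c p k / (of_nat k * of_nat p powr (of_nat k * s))" if "prime p" for p k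
  proof -
    have "psi h q p ^ k = ?c p k"
      using that by (simp add: psi_def A_fun_prime expq_mult_nat)
    then show ?thesis
      using that by (simp add: power_mult_distrib powr_minus of_nat_powr_mult_nat prime_gt_0_nat
          power_inverse divide_inverse mult.assoc)
  qed
  have "infsum ?f {1..} = exp (\<Sum>\<^sub>\<infinity>p\<in>{p. prime p}. \<Sum>\<^sub>\<infinity>k\<in>{1::nat..}. ?f p ^ k / of_nat k)"
  proof (rule euler_product_exp)
    show "?f 1 = 1" by (simp add: psi_def A_fun_def)
    show "?f (m * n) = ?f m * ?f n" if "m > 0" "n > 0" for m n
      using that by (simp add: psi_def A_fun_mult ring_distribs expq_add powr_times_real)
    show "(\<lambda>n. norm (?f n)) summable_on {1..}"
      using summable_on_norm_powr by (simp add: norm_mult psi_def)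
    have "(\<lambda>p. \<Sum>\<^sub>\<infinity>k\<in>{1::nat..}. ?f p ^ k / of_nat k) summable_on {p. prime p} \<longleftrightarrow>
      (\<lambda>p. \<Sum>\<^sub>\<infinity>k\<in>{1..}. ?c p k / (of_nat k * of_nat p powr (of_nat k * s))) summable_on {p. prime p}"
      by (intro summable_on_cong infsum_cong eq) simp
    then show "(\<lambda>p. \<Sum>\<^sub>\<infinity>k\<in>{1::nat..}. ?f p ^ k / of_nat k) summable_on {p. prime p}"
      using summable_on_primes[OF bd] by blast
  qed
  also have "(\<Sum>\<^sub>\<infinity>p\<in>{p. prime p}. \<Sum>\<^sub>\<infinity>k\<in>{1::nat..}. ?f p ^ k / of_nat k) =
      (\<Sum>\<^sub>\<infinity>p\<in>{p. prime p}. \<Sum>\<^sub>\<infinity>k\<in>{1..}. ?c p k / (of_nat k * of_nat p powr (of_nat k * s)))"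
    by (intro infsum_cong eq) simp
  also have "\<dots> = prime_powers_sum s ?c"
    by (rule infsum_primes_powers[OF bd])
  finally show ?thesis by (simp add: L_psi_def)
qed

lemma L_power_eq_exp:
  assumes "bounded_coeff (\<lambda>p k. X (int (p ^ k)))"
  shows "L_power X s a = exp (a * prime_powers_sum s (\<lambda>p k. X (int (p ^ k))))"
  unfolding L_power_def infsum_primes_powers[OF assms] ..

lemma zeta_power_eq_exp: "zeta_power s a = exp (a * prime_powers_sum s (\<lambda>_ _. 1))"
  unfolding zeta_power_def
  by (subst infsum_primes_powers) (auto intro: bounded_coeffI[of _ 1])

text \<open>The third sum may start at \<open>k = 1\<close>, where its terms vanish.\<close>

lemma U_fun_eq:
  "U_fun h q s =
     - (of_int (moebius_mu q) / of_nat (totient q)) *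
         prime_powers_sum s (\<lambda>p k. if p \<in> prime_factors q then 1 else 0)
     + prime_powers_sum s (\<lambda>p k. if p \<in> prime_factors q then expq q (h * int (p ^ k)) else 0)
     + prime_powers_sum s (\<lambda>p k. expq q (h * int p * int k) + (-1) * expq q (h * int (p ^ k)))"
proof -
  let ?d = "\<lambda>p k. expq q (h * int p * int k) + (-1) * expq q (h * int (p ^ k))"
  have bd: "bounded_coeff ?d"
    by (intro bounded_coeff_add bounded_coeff_cmult) (auto intro: bounded_coeffI[of _ 1])
  have "(\<Sum>\<^sub>\<infinity>p\<in>{p::nat. prime p}. \<Sum>\<^sub>\<infinity>k\<in>{2::nat..}.
      (expq q (int p * h * int k) - expq q (int (p ^ k) * h)) / (of_nat k * of_nat p powr (s * of_nat k))) =
      (\<Sum>\<^sub>\<infinity>p\<in>{p. prime p}. \<Sum>\<^sub>\<infinity>k\<in>{1..}. ?d p k / (of_nat k * of_nat p powr (of_nat k * s)))"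
  proof (intro infsum_cong infsum_cong_neutral)
    fix p k :: nat assume "k \<in> {1..} - {2..}"
    then have "k = 1" by auto
    then show "?d p k / (of_nat k * of_nat p powr (of_nat k * s)) = 0" by simp
  qed (auto simp: mult_ac)
  also have "\<dots> = prime_powers_sum s ?d"
    by (rule infsum_primes_powers[OF bd])
  finally have "(\<Sum>\<^sub>\<infinity>p\<in>{p::nat. prime p}. \<Sum>\<^sub>\<infinity>k\<in>{2::nat..}.
      (expq q (int p * h * int k) - expq q (int (p ^ k) * h)) / (of_nat k * of_nat p powr (s * of_nat k))) =
      prime_powers_sum s ?d" .
  moreover have "bounded_coeff (\<lambda>_ _. 1)" "bounded_coeff (\<lambda>p k. expq q (h * int (p ^ k)))"
    by (intro bounded_coeffI[of _ 1]; simp)+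
  ultimately show ?thesis
    unfolding U_fun_def by (simp only: sum_prime_factors_powers)
qed

end

section \<open>Comparison of coefficients at prime powers\<close>

lemma norm_dirichlet_character_le:
  assumes "dirichlet_character q X" "q > 0"
  shows "norm (X n) \<le> 1"
proof (cases "coprime n (int q)")
  case True
  then show ?thesis
    using power_eq_1_iff[OF dirichlet_character_root_of_unity[OF assms(1)]] assms(2) by auto
next
  case False
  then have "X n = 0" using dirichlet_character_eq_0_iff[OF assms(1)] by simp
  then show ?thesis by simp
qed

text \<open>If \<open>p\<close> divides \<open>q\<close>, all characters vanish at
  \<open>p ^ k\<close> and both sides are 0. Otherwise \<open>h * p ^ k\<close> is a unit, and
  \<open>sum_gauss_sum_cnj\<close> applies with the principal character split off as the Moebius
  term.\<close>

lemma expq_eq_character_sum: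
  assumes "coprime h (int q)" "q > 1" "prime p" "k \<ge> 1"
  shows "(\<Sum>X | dirichlet_character q X \<and> X \<noteq> principal_character q.
      gauss_sum q X * cnj (X h) / of_nat (totient q) * cnj (X (int (p ^ k))))
    + of_int (moebius_mu q) / of_nat (totient q) * (if p \<in> prime_factors q then 0 else 1)
    = (if p \<in> prime_factors q then 0 else expq q (h * int (p ^ k)))"
proof (cases "p dvd q")
  case True
  then have "p \<in> prime_factors q"
    using assms by (simp add: in_prime_factors_iff)
  moreover have "\<not> coprime (int (p ^ k)) (int q)"
    using True assms by (auto simp: coprime_int_iff simp del: of_nat_power dest: prime_gt_1_nat coprime_common_divisor[of _ _ p])
  ultimately show ?thesis
    by (auto intro!: sum.neutral simp: dirichlet_character_eq_0_iff simp del: of_nat_power)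
next
  case False
  let ?D = "{X. dirichlet_character q X}" and ?x = "principal_character q"
  have cop: "coprime (h * int (p ^ k)) (int q)"
    using assms False prime_imp_coprime[of p q] by (simp add: coprime_int_iff del: of_nat_power)
  have fin: "finite ?D" using finite_dirichlet_characters assms by simp
  let ?g = "\<lambda>X. gauss_sum q X * cnj (X (h * int (p ^ k)))"
  have "of_nat (totient q) * expq q (h * int (p ^ k)) = (\<Sum>X\<in>?D. ?g X)"
    using sum_gauss_sum_cnj[OF assms(2) cop] by simp
  also have "\<dots> = ?g ?x + (\<Sum>X\<in>?D - {?x}. ?g X)"
    using fin dirichlet_character_principal by (intro sum.remove) auto
  also have "?g ?x = of_int (moebius_mu q)"
    using cop assms gauss_sum_principal[of q] by (simp add: principal_character_def)
  also have "?D - {?x} = {X. dirichlet_character q X \<and> X \<noteq> ?x}" by auto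
  also have "(\<Sum>X | dirichlet_character q X \<and> X \<noteq> ?x. ?g X) =
      (\<Sum>X | dirichlet_character q X \<and> X \<noteq> ?x. gauss_sum q X * cnj (X h) * cnj (X (int (p ^ k))))"
    by (intro sum.cong refl) (auto simp: dirichlet_character_mult)
  finally have "expq q (h * int (p ^ k)) = (of_int (moebius_mu q) +
      (\<Sum>X | dirichlet_character q X \<and> X \<noteq> ?x. gauss_sum q X * cnj (X h) * cnj (X (int (p ^ k)))))
        / of_nat (totient q)"
    using assms by (simp add: field_simps)
  then show ?thesis
    using False by (simp add: in_prime_factors_iff add_divide_distrib sum_divide_distrib add.commute mult_ac)
qed

theorem theorem2p3:
  fixes h :: int and q :: nat and s :: complex
  assumes "coprime h (int q)" and "q > 2" and "Re s > 1"
  shows "L_psi h q s =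
    (\<Prod>X | dirichlet_character q X \<and> X \<noteq> principal_character q.
        L_power (\<lambda>n. cnj (X n)) s (gauss_sum q X * cnj (X h) / of_nat (totient q)))
    * zeta_power s (of_int (moebius_mu q) / of_nat (totient q))
    * exp (U_fun h q s)"
proof -
  let ?D = "{X. dirichlet_character q X \<and> X \<noteq> principal_character q}"
  let ?a = "\<lambda>X. gauss_sum q X * cnj (X h) / of_nat (totient q)"
  let ?m = "of_int (moebius_mu q) / of_nat (totient q) :: complex"
  let ?T = "prime_powers_sum s"
  let ?chi = "\<lambda>X p k. cnj (X (int (p ^ k)))"
  let ?i = "\<lambda>p k::nat. if p \<in> prime_factors q then 1 else 0 :: complex"
  let ?e = "\<lambda>p k. expq q (h * int (p ^ k))"
  let ?ie = "\<lambda>p k. if p \<in> prime_factors q then ?e p k else 0"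
  let ?d = "\<lambda>p k. expq q (h * int p * int k) + (-1) * ?e p k"
  have fin: "finite ?D"
    by (rule finite_subset[OF _ finite_dirichlet_characters[of q]]) (use assms in auto)
  have bd_chi: "bounded_coeff (?chi X)" if "X \<in> ?D" for X
    using that assms norm_dirichlet_character_le by (intro bounded_coeffI[of _ 1]) auto
  have bd: "bounded_coeff (\<lambda>_ _. 1)" "bounded_coeff ?i" "bounded_coeff ?ie" "bounded_coeff ?e"
      "bounded_coeff (\<lambda>p k. expq q (h * int p * int k))"
    by (intro bounded_coeffI[of _ 1]; simp)+
  have bd_sum: "bounded_coeff (\<lambda>p k. \<Sum>X\<in>?D. ?a X * ?chi X p k)"
    using fin bd_chi by (intro bounded_coeff_sum bounded_coeff_cmult) auto
  \<comment> \<open>The terms with \<open>?i\<close> and \<open>?ie\<close> correct the primes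
    dividing \<open>q\<close>, and \<open>?d\<close> exchanges the exponent \<open>p ^ k\<close> for
    \<open>p * k\<close>; linearity then separates the series.\<close>
  have "?T (\<lambda>p k. expq q (h * int p * int k)) =
      ?T (\<lambda>p k. (\<Sum>X\<in>?D. ?a X * ?chi X p k) + ?m * 1 + (- ?m) * ?i p k + ?ie p k + ?d p k)"
  proof (rule prime_powers_sum_cong[OF assms(3)])
    fix p k :: nat assume "prime p" "k \<ge> 1"
    then show "expq q (h * int p * int k) =
        (\<Sum>X\<in>?D. ?a X * ?chi X p k) + ?m * 1 + (- ?m) * ?i p k + ?ie p k + ?d p k"
      using expq_eq_character_sum[OF assms(1), of p k] assms(2)
      by (cases "p \<in> prime_factors q") (auto simp: algebra_simps)
  qed
  also have "\<dots> = ?T (\<lambda>p k. \<Sum>X\<in>?D. ?a X * ?chi X p k) + ?T (\<lambda>_ _. ?m * 1)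
      + ?T (\<lambda>p k. (- ?m) * ?i p k) + ?T ?ie + ?T ?d"
    by (simp only: prime_powers_sum_add[OF assms(3)] bounded_coeff_add bounded_coeff_cmult bd bd_sum)
  also have "?T (\<lambda>p k. \<Sum>X\<in>?D. ?a X * ?chi X p k) = (\<Sum>X\<in>?D. ?a X * ?T (?chi X))"
    by (simp only: prime_powers_sum_sum[OF assms(3) fin] bounded_coeff_cmult bd_chi
        prime_powers_sum_cmult[OF assms(3)])
  also have "?T (\<lambda>_ _. ?m * 1) = ?m * ?T (\<lambda>_ _. 1)"
    by (rule prime_powers_sum_cmult[OF assms(3)])
  also have "?T (\<lambda>p k. (- ?m) * ?i p k) = (- ?m) * ?T ?i"
    by (rule prime_powers_sum_cmult[OF assms(3)])
  finally have "?T (\<lambda>p k. expq q (h * int p * int k)) =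
      (\<Sum>X\<in>?D. ?a X * ?T (?chi X)) + ?m * ?T (\<lambda>_ _. 1) + U_fun h q s"
    by (simp only: U_fun_eq[OF assms(3)] add.assoc)
  \<comment> \<open>The powers are defined as exponentials of these same series, so exponentiating
    the finite sum over characters raises no question of branches.\<close>
  then have "L_psi h q s = (\<Prod>X\<in>?D. exp (?a X * ?T (?chi X))) * exp (?m * ?T (\<lambda>_ _. 1)) * exp (U_fun h q s)"
    by (simp only: L_psi_eq_exp[OF assms(3)] exp_add exp_sum[OF fin])
  also have "(\<Prod>X\<in>?D. exp (?a X * ?T (?chi X))) = (\<Prod>X\<in>?D. L_power (\<lambda>n. cnj (X n)) s (?a X))"
    by (intro prod.cong refl L_power_eq_exp[OF assms(3), symmetric] bd_chi)
  finally show ?thesis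
    by (simp only: zeta_power_eq_exp[OF assms(3)])
qed

end
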